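(* Let $d\geq 1$ be a real number. Let $H_1$ be a connected, locally finite graph with one or two ends, and let $H_2$ be a Cayley graph of a finitely generated group (with respect to a finite generating set) with volume growth at least polynomial of degree $d$. Let $G=H_1\times H_2$ be the direct product of graphs. Then for every $p$ with $1\leq p<\frac{d+1}{2}$, every harmonic function $f$ on the vertices of $G$ whose gradient $\nabla f$ belongs to $\ell^p$ is constant.
   Context: Graphs are simple, undirected and connected; $v\sim w$ denotes adjacency. Ends: an end of a graph is a function $\xi$ assigning to each finite set $K$ of vertices an infinite connected component $\xi(K)$ of the complement of $K$, such that $\xi(K)\cap\xi(K')\neq\varnothing$ for all finite $K,K'$. Direct product of graphs: given $H_1=(X_1,E_1)$ and $H_2=(X_2,E_2)$, the graph $H_1\times H_2$ has vertex set $X_1\times X_2$, and $(x_1,x_2)$ and $(x_1',x_2')$ are adjacent if either $x_1\sim x_1'$ and $x_2=x_2'$, or $x_1=x_1'$ and $x_2\sim x_2'$. Volume growth at least polynomial of degree $d$: there is a constant $c>0$ such that every ball of radius $n\geq 1$ in $H_2$ contains at least $c\,n^d$ vertices. Harmonic functions: a real-valued function $f$ on the vertex set $V$ of a locally finite graph is harmonic if $f(v)=\frac{1}{\deg(v)}\sum_{w\sim v}f(w)$ for all $v\in V$, where $\deg(v)$ is the degree of $v$. The gradient of $f$ is the function on edges $(v,w)$ given by $\nabla f(v,w)=f(w)-f(v)$; it is in $\ell^p$ if $\sum_{(v,w)}|f(w)-f(v)|^p<\infty$, the sum being over all edges. *)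

theory Defs
  imports "HOL-Analysis.Analysis" "HOL-Algebra.Generated_Groups"
begin

record 'a ugraph =
  verts :: "'a set"
  adj :: "'a \<Rightarrow> 'a \<Rightarrow> bool"

definition simple_graph :: "'a ugraph \<Rightarrow> bool" where
  "simple_graph G \<longleftrightarrow>
     (\<forall>v w. adj G v w \<longrightarrow> v \<in> verts G \<and> w \<in> verts G) \<and>
     (\<forall>v w. adj G v w \<longrightarrow> adj G w v) \<and>
     (\<forall>v. \<not> adj G v v)"

definition connected_graph :: "'a ugraph \<Rightarrow> bool" where
  "connected_graph G \<longleftrightarrow> verts G \<noteq> {} \<and> (\<forall>v\<in>verts G. \<forall>w\<in>verts G. (adj G)\<^sup>*\<^sup>* v w)"

definition nbrs :: "'a ugraph \<Rightarrow> 'a \<Rightarrow> 'a set" where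
  "nbrs G v = {w. adj G v w}"

definition vdegree :: "'a ugraph \<Rightarrow> 'a \<Rightarrow> nat" where
  "vdegree G v = card (nbrs G v)"

definition locally_finite_graph :: "'a ugraph \<Rightarrow> bool" where
  "locally_finite_graph G \<longleftrightarrow> (\<forall>v\<in>verts G. finite (nbrs G v))"

definition delete_verts :: "'a ugraph \<Rightarrow> 'a set \<Rightarrow> 'a ugraph" where
  "delete_verts G K =
     \<lparr>verts = verts G - K, adj = (\<lambda>v w. adj G v w \<and> v \<notin> K \<and> w \<notin> K)\<rparr>"

definition graph_components :: "'a ugraph \<Rightarrow> 'a set set" where
  "graph_components G = (\<lambda>v. {w. (adj G)\<^sup>*\<^sup>* v w}) ` verts G"

(* The extensional function space PiE makes two ends equal exactly when they agree on all
   finite vertex sets, so that ends can be counted with card. *)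
definition graph_ends :: "'a ugraph \<Rightarrow> ('a set \<Rightarrow> 'a set) set" where
  "graph_ends G =
     {\<xi> \<in> (\<Pi>\<^sub>E K \<in> {K. K \<subseteq> verts G \<and> finite K}.
             {C \<in> graph_components (delete_verts G K). infinite C}).
      \<forall>K K'. K \<subseteq> verts G \<and> finite K \<and> K' \<subseteq> verts G \<and> finite K' \<longrightarrow> \<xi> K \<inter> \<xi> K' \<noteq> {}}"

definition graph_prod :: "'a ugraph \<Rightarrow> 'b ugraph \<Rightarrow> ('a \<times> 'b) ugraph" where
  "graph_prod H1 H2 =
     \<lparr>verts = verts H1 \<times> verts H2,
      adj = (\<lambda>(x1, x2) (y1, y2).
               adj H1 x1 y1 \<and> x2 = y2 \<and> x2 \<in> verts H2 \<or>
               x1 = y1 \<and> x1 \<in> verts H1 \<and> adj H2 x2 y2)\<rparr>"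

(* S need not be symmetric; loops, which arise when the identity lies in S, are dropped so
   that the graph is simple. *)
definition cayley_graph :: "('b, 'm) monoid_scheme \<Rightarrow> 'b set \<Rightarrow> 'b ugraph" where
  "cayley_graph \<Gamma> S =
     \<lparr>verts = carrier \<Gamma>,
      adj = (\<lambda>x y. x \<in> carrier \<Gamma> \<and> y \<in> carrier \<Gamma> \<and> x \<noteq> y \<and>
                    (\<exists>s\<in>S. y = x \<otimes>\<^bsub>\<Gamma>\<^esub> s \<or> x = y \<otimes>\<^bsub>\<Gamma>\<^esub> s))\<rparr>"

(* Distance at most n means that some walk with at most n edges joins the two vertices. *)
definition graph_ball :: "'a ugraph \<Rightarrow> 'a \<Rightarrow> nat \<Rightarrow> 'a set" where
  "graph_ball G v n = {w \<in> verts G. \<exists>k\<le>n. (adj G ^^ k) v w}"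

definition growth_at_least :: "'a ugraph \<Rightarrow> real \<Rightarrow> bool" where
  "growth_at_least G d \<longleftrightarrow>
     (\<exists>c>0. \<forall>v\<in>verts G. \<forall>n\<ge>1. real (card (graph_ball G v n)) \<ge> c * real n powr d)"

definition harmonic_on_graph :: "'a ugraph \<Rightarrow> ('a \<Rightarrow> real) \<Rightarrow> bool" where
  "harmonic_on_graph G f \<longleftrightarrow>
     (\<forall>v\<in>verts G. f v = 1 / real (vdegree G v) * (\<Sum>w\<in>nbrs G v. f w))"

definition gradient :: "('a \<Rightarrow> real) \<Rightarrow> 'a \<times> 'a \<Rightarrow> real" where
  "gradient f = (\<lambda>(v, w). f w - f v)"

(* Every edge is counted in both orientations; this only doubles the sum. *)
definition gradient_in_lp :: "'a ugraph \<Rightarrow> real \<Rightarrow> ('a \<Rightarrow> real) \<Rightarrow> bool" where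
  "gradient_in_lp G p f \<longleftrightarrow>
     (\<lambda>e. \<bar>gradient f e\<bar> powr p) summable_on {(v, w). adj G v w}"

lemma simple_graph_cayley_graph: "simple_graph (cayley_graph \<Gamma> S)"
  by (auto simp: simple_graph_def cayley_graph_def)

lemma simple_graph_graph_prod:
  assumes "simple_graph H1" "simple_graph H2"
  shows "simple_graph (graph_prod H1 H2)"
  using assms by (auto simp: simple_graph_def graph_prod_def)

end

theory Submission
  imports Defs
begin

text \<open>
  On a product graph the Laplacian splits as \<open>\<Delta> = \<Delta>\<^sub>1 + \<Delta>\<^sub>2\<close>, each summand acting on one coordinate
  only, so \<open>\<Delta>\<^sub>1\<close> and \<open>\<Delta>\<^sub>2\<close> commute. Let \<open>f\<close> be harmonic with gradient in \<open>\<ell>\<^sup>p\<close>. All that the argument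
  keeps of the \<open>\<ell>\<^sup>p\<close> condition is that the gradient vanishes at infinity, in the sense that only finitely
  many edges carry a gradient of absolute value at least \<open>\<epsilon>\<close>.

  The function \<open>g = \<Delta>\<^sub>2 f\<close> is harmonic because \<open>\<Delta> \<Delta>\<^sub>2 f = \<Delta>\<^sub>2 \<Delta> f = 0\<close>. It vanishes at infinity
  because it is a sum of boundedly many values of the gradient. On an infinite connected graph the maximum
  principle makes such a function zero (lemma \<open>harmonic_vanishing_eq_0\<close>). Hence \<open>f\<close> is harmonic in
  its second coordinate alone.

  For an edge \<open>x \<sim> x'\<close> of the first factor, the function \<open>y \<mapsto> f (x', y) - f (x, y)\<close> is therefore
  harmonic on the second factor, and it consists of gradient values of \<open>f\<close>, so the maximum principle applies
  again and gives \<open>f (x', y) = f (x, y)\<close>. Thus \<open>f\<close> depends on \<open>y\<close> only, and each of its increments along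
  an edge of the second factor is repeated over the infinitely many vertices of the first factor. As the
  gradient vanishes at infinity, all these increments are zero (lemma \<open>harmonic_on_product_constant\<close>).

  It remains to see that the factors are infinite and that Cayley graphs are connected with bounded
  degree: a graph with an end is infinite, and so is a graph whose balls have unbounded size.
\<close>

section \<open>Laplacian and maximum principle\<close>

text \<open>
  The Laplacian is left without the division by the degree: this makes it additive over the factors
  of a product graph.
\<close>

definition laplacian :: "'a ugraph \<Rightarrow> ('a \<Rightarrow> real) \<Rightarrow> 'a \<Rightarrow> real" where
  "laplacian G f v = (\<Sum>w\<in>nbrs G v. f w - f v)"

definition vanishes_at_infinity_on :: "'a set \<Rightarrow> ('a \<Rightarrow> real) \<Rightarrow> bool" where
  "vanishes_at_infinity_on A u \<longleftrightarrow> (\<forall>\<epsilon>>0. finite {a \<in> A. \<epsilon> \<le> \<bar>u a\<bar>})"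

lemma simple_graph_nbrs_subset: "simple_graph G \<Longrightarrow> nbrs G v \<subseteq> verts G"
  by (auto simp: simple_graph_def nbrs_def)

lemma laplacian_uminus: "laplacian G (\<lambda>v. - f v) v = - laplacian G f v"
  by (simp add: laplacian_def sum_negf[symmetric])

lemma laplacian_diff: "laplacian G (\<lambda>v. f v - g v) v = laplacian G f v - laplacian G g v"
  by (simp add: laplacian_def sum_subtractf[symmetric] algebra_simps)

lemma connected_graph_invariant:
  assumes "connected_graph G" "v \<in> verts G" "w \<in> verts G" "P v"
    and step: "\<And>a b. adj G a b \<Longrightarrow> P a \<Longrightarrow> P b"
  shows "P w"
proof -
  have "(adj G)\<^sup>*\<^sup>* v w"
    using assms by (auto simp: connected_graph_def)
  then show ?thesis
    by induction (use assms in auto)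
qed

text \<open>
  This makes the degree by which harmonicity divides positive; at an isolated vertex, where \<open>1 / 0 = 0\<close>,
  harmonicity would instead force the value 0.
\<close>

lemma nbrs_nonempty:
  assumes "connected_graph G" "infinite (verts G)" "v \<in> verts G"
  shows "nbrs G v \<noteq> {}"
proof
  assume empty: "nbrs G v = {}"
  have "w = v" if "w \<in> verts G" for w
    by (rule connected_graph_invariant[OF assms(1) assms(3) that, where P = "\<lambda>u. u = v"])
      (use empty in \<open>auto simp: nbrs_def\<close>)
  then have "verts G \<subseteq> {v}" by auto
  then show False
    using assms(2) finite_subset by blast
qed

lemma laplacian_eq_0_if_harmonic:
  assumes "harmonic_on_graph G f" "v \<in> verts G" "finite (nbrs G v)" "nbrs G v \<noteq> {}"
  shows "laplacian G f v = 0"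
proof -
  have "real (card (nbrs G v)) > 0"
    using assms by (simp add: card_gt_0_iff)
  moreover have "f v = 1 / real (card (nbrs G v)) * (\<Sum>w\<in>nbrs G v. f w)"
    using assms by (auto simp: harmonic_on_graph_def vdegree_def)
  ultimately show ?thesis
    by (simp add: laplacian_def sum_subtractf field_simps)
qed

text \<open>
  If the function is positive somewhere, vanishing at infinity makes it attain its maximum. At a maximum
  the terms of the Laplacian are all nonpositive, so the maximum spreads to the neighbours and, by
  connectedness, to the infinitely many vertices of the graph, which contradicts vanishing at infinity.
\<close>

lemma harmonic_vanishing_le_0:
  assumes G: "simple_graph G" "connected_graph G" "locally_finite_graph G" "infinite (verts G)"
    and harm: "\<And>v. v \<in> verts G \<Longrightarrow> laplacian G u v = 0"
    and van: "vanishes_at_infinity_on (verts G) u"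
    and v: "v \<in> verts G"
  shows "u v \<le> 0"
proof (rule ccontr)
  assume "\<not> u v \<le> 0"
  then have pos: "u v > 0" by simp
  define A where "A = {a \<in> verts G. u v \<le> \<bar>u a\<bar>}"
  have fin: "finite A"
    using van pos by (auto simp: A_def vanishes_at_infinity_on_def)
  have vA: "v \<in> A"
    using v by (auto simp: A_def)
  define M where "M = Max (u ` A)"
  have "M \<in> u ` A"
    unfolding M_def using fin vA by (intro Max_in) auto
  then obtain m where m: "m \<in> A" "u m = M" by auto
  have M_ge: "u v \<le> M"
    unfolding M_def using fin vA by simp
  have max: "u a \<le> M" if "a \<in> verts G" for a
  proof (cases "a \<in> A")
    case True
    then show ?thesis unfolding M_def using fin by simp
  next
    case False
    then show ?thesis using that M_ge by (auto simp: A_def)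
  qed
  have "w \<in> verts G \<and> u w = M" if "w \<in> verts G" for w
  proof (rule connected_graph_invariant[OF G(2) _ that])
    show "m \<in> verts G" "m \<in> verts G \<and> u m = M"
      using m by (auto simp: A_def)
  next
    fix a b assume ab: "adj G a b" and a: "a \<in> verts G \<and> u a = M"
    have sub: "nbrs G a \<subseteq> verts G"
      using G(1) by (rule simple_graph_nbrs_subset)
    have "(\<Sum>w\<in>nbrs G a. u a - u w) = 0"
      using harm[of a] a by (simp add: laplacian_def sum_subtractf)
    moreover have "finite (nbrs G a)"
      using G(3) a by (auto simp: locally_finite_graph_def)
    moreover have "0 \<le> u a - u w" if "w \<in> nbrs G a" for w
      using max sub that a by auto
    ultimately have "\<forall>w\<in>nbrs G a. u a - u w = 0"
      by (subst (asm) sum_nonneg_eq_0_iff) auto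
    moreover have "b \<in> nbrs G a"
      using ab by (simp add: nbrs_def)
    ultimately show "b \<in> verts G \<and> u b = M"
      using sub a by auto
  qed
  then have "verts G \<subseteq> A"
    using M_ge pos by (auto simp: A_def)
  then show False
    using fin G(4) finite_subset by blast
qed

lemma harmonic_vanishing_eq_0:
  assumes G: "simple_graph G" "connected_graph G" "locally_finite_graph G" "infinite (verts G)"
    and harm: "\<And>v. v \<in> verts G \<Longrightarrow> laplacian G u v = 0"
    and van: "vanishes_at_infinity_on (verts G) u"
    and v: "v \<in> verts G"
  shows "u v = 0"
proof -
  have "u v \<le> 0"
    by (rule harmonic_vanishing_le_0[OF G harm van v])
  moreover have "- u v \<le> 0"
    by (rule harmonic_vanishing_le_0[OF G _ _ v, where u = "\<lambda>v. - u v"])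
      (use harm van in \<open>auto simp: laplacian_uminus vanishes_at_infinity_on_def\<close>)
  ultimately show ?thesis by simp
qed

section \<open>Product graphs\<close>

lemma verts_graph_prod [simp]: "verts (graph_prod H1 H2) = verts H1 \<times> verts H2"
  by (simp add: graph_prod_def)

lemma adj_graph_prod_left: "adj H1 x x' \<Longrightarrow> y \<in> verts H2 \<Longrightarrow> adj (graph_prod H1 H2) (x, y) (x', y)"
  by (simp add: graph_prod_def)

lemma adj_graph_prod_right: "x \<in> verts H1 \<Longrightarrow> adj H2 y y' \<Longrightarrow> adj (graph_prod H1 H2) (x, y) (x, y')"
  by (simp add: graph_prod_def)

lemma nbrs_graph_prod:
  assumes "x \<in> verts H1" "y \<in> verts H2"
  shows "nbrs (graph_prod H1 H2) (x, y) = (\<lambda>x'. (x', y)) ` nbrs H1 x \<union> Pair x ` nbrs H2 y"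
  using assms by (auto simp: nbrs_def graph_prod_def)

lemma locally_finite_graph_prod:
  assumes "locally_finite_graph H1" "locally_finite_graph H2"
  shows "locally_finite_graph (graph_prod H1 H2)"
  using assms by (auto simp: locally_finite_graph_def nbrs_graph_prod)

lemma connected_graph_prod:
  assumes "connected_graph H1" "connected_graph H2"
  shows "connected_graph (graph_prod H1 H2)"
proof -
  let ?G = "graph_prod H1 H2"
  have "(adj ?G)\<^sup>*\<^sup>* (x, y) (x', y')"
    if "x \<in> verts H1" "x' \<in> verts H1" "y \<in> verts H2" "y' \<in> verts H2" for x x' y y'
  proof -
    have "(adj ?G)\<^sup>*\<^sup>* (x, y) (x', y)"
      by (rule connected_graph_invariant[OF assms(1) that(1) that(2)])
        (use that(3) in \<open>auto intro: rtranclp.rtrancl_into_rtrancl adj_graph_prod_left\<close>)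
    also have "(adj ?G)\<^sup>*\<^sup>* (x', y) (x', y')"
      by (rule connected_graph_invariant[OF assms(2) that(3) that(4)])
        (use that(2) in \<open>auto intro: rtranclp.rtrancl_into_rtrancl adj_graph_prod_right\<close>)
    finally show ?thesis .
  qed
  then show ?thesis
    using assms by (auto simp: connected_graph_def)
qed

lemma laplacian_graph_prod:
  assumes "simple_graph H1" "locally_finite_graph H1" "locally_finite_graph H2"
    and "x \<in> verts H1" "y \<in> verts H2"
  shows "laplacian (graph_prod H1 H2) f (x, y) =
    laplacian H1 (\<lambda>x'. f (x', y)) x + laplacian H2 (\<lambda>y'. f (x, y')) y"
proof -
  have "x \<notin> nbrs H1 x"
    using assms by (auto simp: simple_graph_def nbrs_def)
  then have "(\<lambda>x'. (x', y)) ` nbrs H1 x \<inter> Pair x ` nbrs H2 y = {}"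
    by auto
  moreover have "finite (nbrs H1 x)" "finite (nbrs H2 y)"
    using assms by (auto simp: locally_finite_graph_def)
  ultimately show ?thesis
    using assms
    by (simp add: laplacian_def nbrs_graph_prod sum.union_disjoint sum.reindex inj_on_def)
qed

lemma laplacian_commute:
  "laplacian H1 (\<lambda>x. laplacian H2 (\<lambda>y. f (x, y)) y0) x0 =
   laplacian H2 (\<lambda>y. laplacian H1 (\<lambda>x. f (x, y)) x0) y0"
proof -
  have "laplacian H1 (\<lambda>x. laplacian H2 (\<lambda>y. f (x, y)) y0) x0 =
      (\<Sum>x\<in>nbrs H1 x0. \<Sum>y\<in>nbrs H2 y0. f (x, y) - f (x, y0) - (f (x0, y) - f (x0, y0)))"
    by (simp add: laplacian_def sum_subtractf)
  also have "\<dots> = (\<Sum>y\<in>nbrs H2 y0. \<Sum>x\<in>nbrs H1 x0. f (x, y) - f (x, y0) - (f (x0, y) - f (x0, y0)))"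
    by (rule sum.swap)
  also have "\<dots> = laplacian H2 (\<lambda>y. laplacian H1 (\<lambda>x. f (x, y)) x0) y0"
    unfolding laplacian_def by (intro sum.cong refl) (simp add: sum_subtractf[symmetric] algebra_simps)
  finally show ?thesis .
qed

text \<open>
  With all degrees at most \<open>k\<close>, a partial Laplacian of size \<open>\<epsilon>\<close> needs a gradient of size at least
  \<open>\<epsilon> / (k + 1)\<close> on one of its edges; the \<open>k + 1\<close> keeps the quotient meaningful for \<open>k = 0\<close> and the
  estimate strict.
\<close>

lemma partial_laplacian_vanishes:
  assumes deg: "\<And>y. y \<in> verts H2 \<Longrightarrow> card (nbrs H2 y) \<le> k"
    and grad: "vanishes_at_infinity_on {(v, w). adj (graph_prod H1 H2) v w} (gradient f)"
  shows "vanishes_at_infinity_on (verts (graph_prod H1 H2))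
           (\<lambda>(x, y). laplacian H2 (\<lambda>y'. f (x, y')) y)"
  unfolding vanishes_at_infinity_on_def
proof (intro allI impI)
  fix \<epsilon> :: real assume \<epsilon>: "\<epsilon> > 0"
  let ?G = "graph_prod H1 H2" and ?\<delta> = "\<epsilon> / (real k + 1)"
  let ?E = "{e \<in> {(v, w). adj ?G v w}. ?\<delta> \<le> \<bar>gradient f e\<bar>}"
  let ?A = "{a \<in> verts ?G. \<epsilon> \<le> \<bar>case a of (x, y) \<Rightarrow> laplacian H2 (\<lambda>y'. f (x, y')) y\<bar>}"
  have "?A \<subseteq> fst ` ?E"
  proof
    fix a assume a: "a \<in> ?A"
    obtain x y where xy: "a = (x, y)" by force
    from a xy have x: "x \<in> verts H1" and y: "y \<in> verts H2"
      and large: "\<epsilon> \<le> \<bar>laplacian H2 (\<lambda>y'. f (x, y')) y\<bar>" by auto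
    have "\<exists>y'\<in>nbrs H2 y. ?\<delta> \<le> \<bar>f (x, y') - f (x, y)\<bar>"
    proof (rule ccontr)
      assume "\<not> ?thesis"
      then have small: "\<bar>f (x, y') - f (x, y)\<bar> \<le> ?\<delta>" if "y' \<in> nbrs H2 y" for y'
        using that by force
      have "\<bar>laplacian H2 (\<lambda>y'. f (x, y')) y\<bar> \<le> (\<Sum>y'\<in>nbrs H2 y. \<bar>f (x, y') - f (x, y)\<bar>)"
        unfolding laplacian_def by (rule sum_abs)
      also have "\<dots> \<le> real (card (nbrs H2 y)) * ?\<delta>"
        using sum_bounded_above[of "nbrs H2 y" "\<lambda>y'. \<bar>f (x, y') - f (x, y)\<bar>" ?\<delta>] small by simp
      also have "\<dots> \<le> real k * ?\<delta>"
        using deg[OF y] \<epsilon> by (intro mult_right_mono) auto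
      also have "\<dots> < \<epsilon>"
        using \<epsilon> by (simp add: field_simps)
      finally show False using large by simp
    qed
    then obtain y' where y': "adj H2 y y'" "?\<delta> \<le> \<bar>f (x, y') - f (x, y)\<bar>"
      by (auto simp: nbrs_def)
    then have "((x, y), (x, y')) \<in> ?E"
      using x by (auto simp: gradient_def intro: adj_graph_prod_right)
    then show "a \<in> fst ` ?E"
      unfolding xy by (rule rev_image_eqI) simp
  qed
  moreover have "finite ?E"
    using grad \<epsilon> by (simp add: vanishes_at_infinity_on_def)
  ultimately show "finite ?A"
    using finite_subset by blast
qed

lemma harmonic_on_product_constant:
  assumes H1: "simple_graph H1" "connected_graph H1" "locally_finite_graph H1" "infinite (verts H1)"
    and H2: "simple_graph H2" "connected_graph H2" "locally_finite_graph H2" "infinite (verts H2)"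
    and deg: "\<And>y. y \<in> verts H2 \<Longrightarrow> card (nbrs H2 y) \<le> k"
    and harm: "harmonic_on_graph (graph_prod H1 H2) f"
    and grad: "vanishes_at_infinity_on {(v, w). adj (graph_prod H1 H2) v w} (gradient f)"
  shows "f constant_on verts (graph_prod H1 H2)"
proof -
  let ?G = "graph_prod H1 H2"
  define g where "g = (\<lambda>(x, y). laplacian H2 (\<lambda>y'. f (x, y')) y)"
  have verts_nonempty: "verts H1 \<noteq> {}" "verts H2 \<noteq> {}"
    using H1(4) H2(4) by auto
  have G: "simple_graph ?G" "connected_graph ?G" "locally_finite_graph ?G" "infinite (verts ?G)"
    using H1 H2 verts_nonempty
    by (auto intro: simple_graph_graph_prod connected_graph_prod locally_finite_graph_prod
        dest: finite_cartesian_productD1)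
  have lap_f: "laplacian ?G f v = 0" if "v \<in> verts ?G" for v
    using laplacian_eq_0_if_harmonic[OF harm that _ nbrs_nonempty[OF G(2) G(4) that]] G(3) that
    by (auto simp: locally_finite_graph_def)
  have split: "laplacian H1 (\<lambda>x'. f (x', y)) x = - g (x, y)"
    if "x \<in> verts H1" "y \<in> verts H2" for x y
    using lap_f[of "(x, y)"] laplacian_graph_prod[OF H1(1,3) H2(3) that, of f] that
    by (simp add: g_def)
  have lap_g: "laplacian ?G g v = 0" if "v \<in> verts ?G" for v
  proof -
    obtain x y where v: "v = (x, y)" by force
    with that have x: "x \<in> verts H1" and y: "y \<in> verts H2" by auto
    have "laplacian H1 (\<lambda>x'. g (x', y)) x = laplacian H2 (\<lambda>y'. laplacian H1 (\<lambda>x'. f (x', y')) x) y"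
      by (simp add: g_def laplacian_commute)
    also have "\<dots> = laplacian H2 (\<lambda>y'. - g (x, y')) y"
      using split[OF x] y simple_graph_nbrs_subset[OF H2(1), of y]
      by (auto simp: laplacian_def intro!: sum.cong)
    finally show ?thesis
      using laplacian_graph_prod[OF H1(1,3) H2(3) x y, of g] by (simp add: v laplacian_uminus)
  qed
  have g_0: "g v = 0" if "v \<in> verts ?G" for v
    using harmonic_vanishing_eq_0[OF G lap_g _ that]
      partial_laplacian_vanishes[where ?H1.0 = H1 and f = f, OF deg grad] by (simp add: g_def)

  have left: "f (x', y) = f (x, y)" if xx': "adj H1 x x'" and y: "y \<in> verts H2" for x x' y
  proof -
    have x: "x \<in> verts H1" "x' \<in> verts H1"
      using xx' H1(1) by (auto simp: simple_graph_def)
    let ?u = "\<lambda>y. f (x', y) - f (x, y)"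
    have "?u y = 0"
    proof (rule harmonic_vanishing_eq_0[OF H2 _ _ y])
      show "laplacian H2 ?u z = 0" if "z \<in> verts H2" for z
        using g_0[of "(x, z)"] g_0[of "(x', z)"] x that by (simp add: laplacian_diff g_def)
      show "vanishes_at_infinity_on (verts H2) ?u"
        unfolding vanishes_at_infinity_on_def
      proof (intro allI impI)
        fix \<epsilon> :: real assume "\<epsilon> > 0"
        let ?E = "{e \<in> {(v, w). adj ?G v w}. \<epsilon> \<le> \<bar>gradient f e\<bar>}"
        let ?e = "\<lambda>z. ((x, z), (x', z))"
        have "?e ` {z \<in> verts H2. \<epsilon> \<le> \<bar>?u z\<bar>} \<subseteq> ?E"
          using xx' by (auto simp: gradient_def intro: adj_graph_prod_left)
        moreover have "finite ?E"
          using grad \<open>\<epsilon> > 0\<close> by (simp add: vanishes_at_infinity_on_def)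
        ultimately show "finite {z \<in> verts H2. \<epsilon> \<le> \<bar>?u z\<bar>}"
          by (rule inj_on_finite[of ?e, rotated]) (simp add: inj_on_def)
      qed
    qed
    then show ?thesis by simp
  qed
  have indep: "f (x', y) = f (x, y)" if "x \<in> verts H1" "x' \<in> verts H1" "y \<in> verts H2" for x x' y
    by (rule connected_graph_invariant[OF H1(2) that(1,2)]) (use left that(3) in auto)

  have right: "f (x, y') = f (x, y)" if yy': "adj H2 y y'" and x: "x \<in> verts H1" for x y y'
  proof (rule ccontr)
    assume ne: "f (x, y') \<noteq> f (x, y)"
    define \<epsilon> where "\<epsilon> = \<bar>f (x, y') - f (x, y)\<bar>"
    have y: "y \<in> verts H2" "y' \<in> verts H2"
      using yy' H2(1) by (auto simp: simple_graph_def)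
    let ?E = "{e \<in> {(v, w). adj ?G v w}. \<epsilon> \<le> \<bar>gradient f e\<bar>}"
    let ?e = "\<lambda>z. ((z, y), (z, y'))"
    have "gradient f (?e z) = f (x, y') - f (x, y)" if "z \<in> verts H1" for z
      using indep[OF x that y(1)] indep[OF x that y(2)] by (simp add: gradient_def)
    then have "?e ` verts H1 \<subseteq> ?E"
      using yy' by (auto simp: \<epsilon>_def intro: adj_graph_prod_right)
    moreover have "finite ?E"
      using grad ne by (simp add: vanishes_at_infinity_on_def \<epsilon>_def)
    ultimately have "finite (verts H1)"
      by (rule inj_on_finite[of ?e, rotated]) (simp add: inj_on_def)
    then show False using H1(4) by simp
  qed
  obtain x0 y0 where base: "x0 \<in> verts H1" "y0 \<in> verts H2"
    using verts_nonempty by auto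
  have "f (x, y) = f (x0, y0)" if "x \<in> verts H1" "y \<in> verts H2" for x y
  proof -
    have "f (x0, y) = f (x0, y0)"
      by (rule connected_graph_invariant[OF H2(2) base(2) that(2)]) (use right base in auto)
    then show ?thesis using indep[OF base(1) that] by simp
  qed
  then show ?thesis
    by (auto simp: constant_on_def)
qed

section \<open>Cayley graphs\<close>

text \<open>
  Induction over the generated subgroup works for right multiplication by \<open>h\<close> from an arbitrary
  starting point \<open>x\<close>, since a product \<open>h\<^sub>1 h\<^sub>2\<close> is walked from \<open>x\<close> to \<open>x h\<^sub>1\<close> and on from there.
\<close>

lemma (in group) cayley_graph_walk:
  assumes S: "S \<subseteq> carrier G" and "h \<in> generate G S" and "x \<in> carrier G"
  shows "(adj (cayley_graph G S))\<^sup>*\<^sup>* x (x \<otimes> h)"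
  using assms(2,3)
proof (induction arbitrary: x)
  case one
  then show ?case by simp
next
  case (incl s)
  then have "x \<otimes> s = x \<or> adj (cayley_graph G S) x (x \<otimes> s)"
    using S by (auto simp: cayley_graph_def)
  then show ?case by auto
next
  case (inv s)
  then have s: "s \<in> carrier G" using S by auto
  then have "x = x \<otimes> inv s \<otimes> s"
    using inv by (simp add: m_assoc)
  then have "x \<otimes> inv s = x \<or> adj (cayley_graph G S) x (x \<otimes> inv s)"
    using inv s by (auto simp: cayley_graph_def)
  then show ?case by auto
next
  case (eng h1 h2)
  have h: "h1 \<in> carrier G" "h2 \<in> carrier G"
    using eng.hyps generate_in_carrier[OF S] by auto
  have "(adj (cayley_graph G S))\<^sup>*\<^sup>* x (x \<otimes> h1)"
    using eng by blast
  also have "(adj (cayley_graph G S))\<^sup>*\<^sup>* (x \<otimes> h1) (x \<otimes> h1 \<otimes> h2)"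
    using eng h by blast
  finally show ?case
    using eng.prems h by (simp add: m_assoc)
qed

lemma (in group) connected_cayley_graph:
  assumes "S \<subseteq> carrier G" "generate G S = carrier G"
  shows "connected_graph (cayley_graph G S)"
proof -
  have "(adj (cayley_graph G S))\<^sup>*\<^sup>* x y" if "x \<in> carrier G" "y \<in> carrier G" for x y
  proof -
    have "x \<otimes> (inv x \<otimes> y) = y"
      using that by (simp add: m_assoc[symmetric])
    then show ?thesis
      using cayley_graph_walk[OF assms(1), of "inv x \<otimes> y" x] assms(2) that by simp
  qed
  moreover have "carrier G \<noteq> {}" by blast
  ultimately show ?thesis
    by (simp add: connected_graph_def cayley_graph_def)
qed

lemma (in group) nbrs_cayley_graph_subset:
  assumes "S \<subseteq> carrier G"
  shows "nbrs (cayley_graph G S) y \<subseteq> (\<lambda>s. y \<otimes> s) ` (S \<union> (\<lambda>s. inv s) ` S)"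
proof
  fix z assume "z \<in> nbrs (cayley_graph G S) y"
  then obtain s where s: "s \<in> S" "y \<in> carrier G" "z \<in> carrier G" "z = y \<otimes> s \<or> y = z \<otimes> s"
    by (auto simp: nbrs_def cayley_graph_def)
  have "z = y \<otimes> inv s" if "y = z \<otimes> s"
    using that s assms by (auto simp: m_assoc)
  then show "z \<in> (\<lambda>s. y \<otimes> s) ` (S \<union> (\<lambda>s. inv s) ` S)"
    using s by auto
qed

section \<open>Infinite graphs\<close>

lemma infinite_verts_if_growth:
  assumes growth: "growth_at_least G d" and "d \<ge> 1" and "verts G \<noteq> {}"
  shows "infinite (verts G)"
proof
  assume fin: "finite (verts G)"
  obtain c where c: "c > 0"
    and ball: "\<And>v n. v \<in> verts G \<Longrightarrow> n \<ge> 1 \<Longrightarrow> c * real n powr d \<le> real (card (graph_ball G v n))"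
    using growth by (auto simp: growth_at_least_def)
  obtain v where v: "v \<in> verts G" using assms(3) by auto
  obtain n where n: "real (card (verts G)) / c < real n"
    using reals_Archimedean2 by blast
  then have "real n > 0"
    using c by (smt (verit) divide_nonneg_pos of_nat_0_le_iff)
  then have n1: "n \<ge> 1" by simp
  have "real (card (verts G)) < c * real n"
    using n c by (simp add: field_simps)
  also have "\<dots> \<le> c * real n powr d"
    using powr_mono[OF assms(2), of "real n"] n1 c by simp
  also have "\<dots> \<le> real (card (graph_ball G v n))"
    by (rule ball[OF v n1])
  also have "\<dots> \<le> real (card (verts G))"
    using fin by (auto simp: graph_ball_def intro!: card_mono)
  finally show False by simp
qed

text \<open>
  Already the component that an end assigns to the empty set of vertices is an infinite set of vertices.
\<close>

lemma infinite_verts_if_end: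
  assumes G: "simple_graph G" and \<xi>: "\<xi> \<in> graph_ends G"
  shows "infinite (verts G)"
proof -
  have "\<xi> {} \<in> {C \<in> graph_components (delete_verts G {}). infinite C}"
    using \<xi> by (auto simp: graph_ends_def PiE_def Pi_def)
  then obtain v where v: "v \<in> verts G" and inf: "infinite {w. (adj G)\<^sup>*\<^sup>* v w}"
    by (auto simp: graph_components_def delete_verts_def)
  have "w \<in> verts G" if "(adj G)\<^sup>*\<^sup>* v w" for w
    using that by induction (use v G in \<open>auto simp: simple_graph_def\<close>)
  then have "{w. (adj G)\<^sup>*\<^sup>* v w} \<subseteq> verts G" by auto
  then show ?thesis
    using inf finite_subset by blast
qed

section \<open>Summable gradients\<close>

lemma summable_on_imp_vanishes_at_infinity_on:
  fixes u :: "'a \<Rightarrow> real"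
  assumes sum: "u summable_on A" and nonneg: "\<And>a. a \<in> A \<Longrightarrow> 0 \<le> u a"
  shows "vanishes_at_infinity_on A u"
  unfolding vanishes_at_infinity_on_def
proof (intro allI impI, rule ccontr)
  fix \<epsilon> :: real assume \<epsilon>: "\<epsilon> > 0"
  assume inf: "infinite {a \<in> A. \<epsilon> \<le> \<bar>u a\<bar>}"
  obtain n where n: "infsum u A / \<epsilon> < real n"
    using reals_Archimedean2 by blast
  obtain F where F: "finite F" "card F = n" "F \<subseteq> {a \<in> A. \<epsilon> \<le> \<bar>u a\<bar>}"
    using infinite_arbitrarily_large[OF inf] by blast
  have "real n * \<epsilon> \<le> sum u F"
    using sum_bounded_below[of F \<epsilon> u] F nonneg by force
  also have "\<dots> \<le> infsum u A"
    using F nonneg by (intro finite_sum_le_infsum sum) auto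
  finally show False
    using n \<epsilon> by (simp add: field_simps)
qed

lemma gradient_in_lp_imp_vanishes:
  assumes "gradient_in_lp G p f" "p > 0"
  shows "vanishes_at_infinity_on {(v, w). adj G v w} (gradient f)"
  unfolding vanishes_at_infinity_on_def
proof (intro allI impI)
  fix \<epsilon> :: real assume \<epsilon>: "\<epsilon> > 0"
  let ?E = "{(v, w). adj G v w}"
  have "vanishes_at_infinity_on ?E (\<lambda>e. \<bar>gradient f e\<bar> powr p)"
    using assms(1) by (intro summable_on_imp_vanishes_at_infinity_on) (auto simp: gradient_in_lp_def)
  then have "finite {e \<in> ?E. \<epsilon> powr p \<le> \<bar>\<bar>gradient f e\<bar> powr p\<bar>}"
    using \<epsilon> by (simp add: vanishes_at_infinity_on_def)
  moreover have "{e \<in> ?E. \<epsilon> \<le> \<bar>gradient f e\<bar>} \<subseteq> {e \<in> ?E. \<epsilon> powr p \<le> \<bar>\<bar>gradient f e\<bar> powr p\<bar>}"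
    using \<epsilon> assms(2) by (auto intro: powr_mono2)
  ultimately show "finite {e \<in> ?E. \<epsilon> \<le> \<bar>gradient f e\<bar>}"
    by (rule rev_finite_subset)
qed

section \<open>The product of a graph with ends and a Cayley graph\<close>

theorem proposition2:
  fixes d p :: real
    and H1 :: "'a ugraph"
    and \<Gamma> :: "('b, 'm) monoid_scheme"
    and S :: "'b set"
    and f :: "'a \<times> 'b \<Rightarrow> real"
  assumes "d \<ge> 1"
    and "simple_graph H1"
    and "connected_graph H1"
    and "locally_finite_graph H1"
    and "card (graph_ends H1) = 1 \<or> card (graph_ends H1) = 2"
    and "group \<Gamma>"
    and "finite S"
    and "S \<subseteq> carrier \<Gamma>"
    and "generate \<Gamma> S = carrier \<Gamma>"
    and "growth_at_least (cayley_graph \<Gamma> S) d"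
    and "1 \<le> p"
    and "p < (d + 1) / 2"
    and "harmonic_on_graph (graph_prod H1 (cayley_graph \<Gamma> S)) f"
    and "gradient_in_lp (graph_prod H1 (cayley_graph \<Gamma> S)) p f"
  shows "f constant_on verts (graph_prod H1 (cayley_graph \<Gamma> S))"
proof -
  let ?H2 = "cayley_graph \<Gamma> S"
  interpret group \<Gamma> by fact
  have "graph_ends H1 \<noteq> {}"
    using assms(5) by auto
  then have inf1: "infinite (verts H1)"
    using infinite_verts_if_end[OF assms(2)] by blast
  have conn2: "connected_graph ?H2"
    by (rule connected_cayley_graph) fact+
  have inf2: "infinite (verts ?H2)"
    by (rule infinite_verts_if_growth[OF assms(10,1)]) (use conn2 in \<open>simp add: connected_graph_def\<close>)
  let ?T = "S \<union> (\<lambda>s. inv\<^bsub>\<Gamma>\<^esub> s) ` S"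
  have finT: "finite ?T"
    using assms(7) by simp
  have nbrs2: "nbrs ?H2 y \<subseteq> (\<lambda>s. y \<otimes>\<^bsub>\<Gamma>\<^esub> s) ` ?T" for y
    by (rule nbrs_cayley_graph_subset) fact
  have "locally_finite_graph ?H2"
    using nbrs2 finT unfolding locally_finite_graph_def by (meson finite_imageI finite_subset)
  moreover have "card (nbrs ?H2 y) \<le> card ?T" for y
    using nbrs2[of y] finT by (rule surj_card_le[rotated])
  moreover have "vanishes_at_infinity_on {(v, w). adj (graph_prod H1 ?H2) v w} (gradient f)"
    using assms(11,14) by (intro gradient_in_lp_imp_vanishes) auto
  ultimately show ?thesis
    using assms(2-4,13) inf1 inf2 conn2 simple_graph_cayley_graph
    by (intro harmonic_on_product_constant[where k = "card ?T"])
qed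

end
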